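(* Let $p$ be a prime number, let $\alpha_1,\ldots,\alpha_n,\beta_1,\ldots,\beta_m\in\mathbb{Q}$ be rational numbers none of which is a nonpositive integer, and let $$h(x)=\sum_{k\ge 0}h_kx^k,\qquad h_k=\frac{(\alpha_1)_k\cdots(\alpha_n)_k}{(\beta_1)_k\cdots(\beta_m)_k}.$$ Assume that $h(x)$ has good reduction modulo $p$, i.e. $h_k\in\mathbb{Z}_{(p)}$ for all $k\ge 0$. Then the series $h(x)\bmod p\in\mathbb{F}_p[\![x]\!]$ is algebraic over $\mathbb{F}_p(x)$.
   Context: For $\gamma\in\mathbb{Q}$ and $k\ge 0$, $(\gamma)_k=\gamma(\gamma+1)\cdots(\gamma+k-1)$ is the rising factorial (with $(\gamma)_0=1$). $\mathbb{Z}_{(p)}$ is the ring of rational numbers with denominator coprime to $p$, and $h(x)\bmod p$ denotes the series obtained by reducing every coefficient to $\mathbb{F}_p=\mathbb{Z}/p\mathbb{Z}$. The parameters are not required to lie in $\mathbb{Z}_{(p)}$. *)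

theory Defs
  imports
    "HOL-Computational_Algebra.Computational_Algebra"
    "HOL-Library.Nonpos_Ints"
    "Berlekamp_Zassenhaus.Finite_Field"
begin

text \<open>
  \<open>localization p\<close> is \<open>\<int>\<^bsub>(p)\<^esub>\<close>; \<^const>\<open>quotient_of\<close> yields the numerator and the (positive)
  denominator in lowest terms.
\<close>

definition localization :: "nat \<Rightarrow> rat set" where
  "localization p = {r. coprime (snd (quotient_of r)) (int p)}"

text \<open>
  The prime field with \<open>p\<close> elements is rendered by the type \<open>'p mod_ring\<close> of residues modulo
  \<open>p = CARD('p)\<close>, so the prime is carried by the type. The reduction map below is meaningful only
  on \<open>localization CARD('p)\<close>: elsewhere the denominator becomes 0 and the value is the junk value 0.
\<close>

definition rat_mod :: "rat \<Rightarrow> 'p::prime_card mod_ring" where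
  "rat_mod r = of_int (fst (quotient_of r)) / of_int (snd (quotient_of r))"

definition good_reduction :: "nat \<Rightarrow> rat fps \<Rightarrow> bool" where
  "good_reduction p h \<longleftrightarrow> (\<forall>k. fps_nth h k \<in> localization p)"

definition fps_mod :: "rat fps \<Rightarrow> 'p::prime_card mod_ring fps" where
  "fps_mod h = Abs_fps (\<lambda>k. rat_mod (fps_nth h k))"

text \<open>\<open>pochhammer a k\<close> is the rising factorial.\<close>

definition hypergeom_series ::
    "nat \<Rightarrow> nat \<Rightarrow> (nat \<Rightarrow> rat) \<Rightarrow> (nat \<Rightarrow> rat) \<Rightarrow> rat fps" where
  "hypergeom_series n m \<alpha> \<beta> =
     Abs_fps (\<lambda>k. (\<Prod>i=1..n. pochhammer (\<alpha> i) k) / (\<Prod>j=1..m. pochhammer (\<beta> j) k))"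

text \<open>
  The field of rational functions \<open>K(x)\<close>, as a subfield of the field \<open>K((x))\<close> of formal Laurent
  series, which also contains \<open>K[[x]]\<close> via \<^const>\<open>fps_to_fls\<close>.
\<close>

definition rational_functions :: "'a::field fls set" where
  "rational_functions =
     {fps_to_fls (fps_of_poly f) / fps_to_fls (fps_of_poly g) | f g. g \<noteq> 0}"

text \<open>Relative version of \<^const>\<open>Polynomial.algebraic\<close>, for a subfield \<open>K\<close> of the ambient field.\<close>

definition algebraic_over :: "'a::field set \<Rightarrow> 'a \<Rightarrow> bool" where
  "algebraic_over K y \<longleftrightarrow> (\<exists>P. (\<forall>i. Polynomial.coeff P i \<in> K) \<and> P \<noteq> 0 \<and> poly P y = 0)"

end

theory Submission
  imports Defs
begin

text \<open>
  Every nonzero rational \<open>x\<close> is \<open>p\<^sup>v \<sqdot> y\<close> with \<open>y\<close> a \<open>p\<close>-adic unit. Its valuation \<open>v\<close> and the residue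
  of \<open>y\<close> modulo \<open>p\<close> (its angular component) are both multiplicative, and for \<open>p\<close>-integral \<open>x\<close> they
  determine \<open>x\<close> modulo \<open>p\<close>. So everything can be read off from these two data, factor by factor.

  Take a single factor \<open>(\<gamma>)\<^sub>k\<close> with \<open>\<gamma>\<close> \<open>p\<close>-integral. Among the numbers \<open>\<gamma> + j\<close>, exactly those with
  \<open>j = r + p i\<close> are divisible by \<open>p\<close>, where \<open>0 \<le> r < p\<close>, and \<open>\<gamma> + r + p i = p (\<gamma>' + i)\<close> for
  \<open>\<gamma>' = (\<gamma> + r) / p\<close> (the Dwork prime of \<open>\<gamma>\<close>). Hence along an arithmetic progression \<open>k = c + p l\<close> the
  sequence \<open>(\<gamma>)\<^sub>k\<close> agrees with \<open>(\<gamma>')\<^sub>l\<close> or \<open>(\<gamma>')\<^sub>l\<^sub>+\<^sub>1\<close>, up to a factor with valuation \<open>e + l\<close> and angular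
  component \<open>C D\<^sup>l\<close>. All iterates of \<open>\<gamma> \<mapsto> \<gamma>'\<close> have a common denominator and bounded numerators, so only
  finitely many sequences occur. If \<open>\<gamma>\<close> is not \<open>p\<close>-integral, then \<open>(\<gamma>)\<^sub>k\<close> has valuation \<open>k v(\<gamma>)\<close> and a
  geometric angular component, and one sequence suffices. Products and inverses inherit this
  self-similarity (\<open>self_similar\<close>): there are a finite set \<open>S\<close> of sequences containing \<open>h\<close> and an
  integer \<open>d\<close> such that sections of members of \<open>S\<close> are members of \<open>S\<close>, up to a twist by valuations
  \<open>e + d l\<close> and angular components \<open>C D\<^sup>l\<close>.

  \<^item> If \<open>d = 0\<close>, the twist shifts valuations by the constant \<open>e\<close> alone. For each sequence only one
    \<open>e\<close> gives an integral twist that is nonzero modulo \<open>p\<close>, and \<open>C\<close>, \<open>D\<close> range over the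
    finite field. So the iterated sections of \<open>h mod p\<close> form a finite set, and \<open>h mod p\<close> is algebraic
    by Christol's argument (\<open>algebraic_if_finitely_many_sections\<close>).

  \<^item> If \<open>d \<noteq> 0\<close>, the slopes \<open>d (1 + p + \<dots> + p\<^sup>t\<^sup>-\<^sup>1)\<close> of the \<open>t\<close>-fold sections are strictly monotone in
    \<open>t\<close>. Some sequence of \<open>S\<close> occurs at two depths, where its two twists differ by a nonconstant
    linear function of \<open>l\<close>. Both twists have nonnegative valuation, so the larger one tends to
    infinity. Hence \<open>h mod p\<close> is a polynomial (\<open>self_similar_eventually_pos_pval\<close>).
\<close>

section \<open>Linear algebra over the field of rational functions\<close>

lemma rational_functionsI_poly: "fps_to_fls (fps_of_poly f) \<in> rational_functions"
  unfolding rational_functions_def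
  by (intro CollectI exI[of _ f] exI[of _ 1]) simp

lemma zero_in_rational_functions: "0 \<in> rational_functions"
  using rational_functionsI_poly[of 0] by simp

lemma one_in_rational_functions: "1 \<in> rational_functions"
  using rational_functionsI_poly[of 1] by simp

lemma X_power_in_rational_functions: "fps_to_fls (fps_X ^ k) \<in> rational_functions"
  using rational_functionsI_poly[of "Polynomial.monom 1 k"] by (simp add: fps_of_poly_monom')

lemma mult_in_rational_functions:
  assumes "x \<in> rational_functions" "y \<in> rational_functions"
  shows "x * y \<in> rational_functions"
proof -
  obtain f g f' g' where
    "x = fps_to_fls (fps_of_poly f) / fps_to_fls (fps_of_poly g)" "g \<noteq> 0"
    "y = fps_to_fls (fps_of_poly f') / fps_to_fls (fps_of_poly g')" "g' \<noteq> 0"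
    using assms by (auto simp: rational_functions_def)
  then have "x * y = fps_to_fls (fps_of_poly (f * f')) / fps_to_fls (fps_of_poly (g * g'))"
    and "g * g' \<noteq> 0"
    by (simp_all add: fps_of_poly_mult fls_times_fps_to_fls)
  then show ?thesis
    unfolding rational_functions_def by blast
qed

lemma add_in_rational_functions:
  assumes "x \<in> rational_functions" "y \<in> rational_functions"
  shows "x + y \<in> rational_functions"
proof -
  obtain f g f' g' where
    "x = fps_to_fls (fps_of_poly f) / fps_to_fls (fps_of_poly g)" "g \<noteq> 0"
    "y = fps_to_fls (fps_of_poly f') / fps_to_fls (fps_of_poly g')" "g' \<noteq> 0"
    using assms by (auto simp: rational_functions_def)
  then have "x + y = fps_to_fls (fps_of_poly (f * g' + f' * g)) / fps_to_fls (fps_of_poly (g * g'))"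
    and "g * g' \<noteq> 0"
    by (simp_all add: fps_of_poly_mult fps_of_poly_add fls_times_fps_to_fls field_simps)
  then show ?thesis
    unfolding rational_functions_def by blast
qed

lemma inverse_in_rational_functions:
  assumes "x \<in> rational_functions"
  shows "inverse x \<in> rational_functions"
proof (cases "x = 0")
  case False
  obtain f g where fg:
    "x = fps_to_fls (fps_of_poly f) / fps_to_fls (fps_of_poly g)" "g \<noteq> 0"
    using assms by (auto simp: rational_functions_def)
  with False have "f \<noteq> 0" by auto
  moreover have "inverse x = fps_to_fls (fps_of_poly g) / fps_to_fls (fps_of_poly f)"
    using fg by simp
  ultimately show ?thesis
    unfolding rational_functions_def by blast
qed (simp add: zero_in_rational_functions)

lemma uminus_in_rational_functions:
  assumes "x \<in> rational_functions"
  shows "- x \<in> rational_functions"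
  using mult_in_rational_functions[OF rational_functionsI_poly[of "-1"] assms]
  by (simp add: fps_of_poly_uminus)

lemma sum_in_rational_functions:
  assumes "\<And>i. i \<in> A \<Longrightarrow> f i \<in> rational_functions"
  shows "(\<Sum>i\<in>A. f i) \<in> rational_functions"
  using assms by (induct A rule: infinite_finite_induct)
    (auto intro: add_in_rational_functions zero_in_rational_functions)

text \<open>
  Gaussian elimination: a homogeneous system with more unknowns (\<open>I\<close>) than equations (\<open>U\<close>) has a
  nontrivial solution. The elimination steps divide by pivots, so the solution stays rational because
  the rational functions are closed under inverses.
\<close>

lemma homogeneous_system_over_rational_functions:
  fixes M :: "'i \<Rightarrow> 'u \<Rightarrow> 'a::field fls"
  assumes "finite U" "finite I" "card U < card I"
    and "\<And>i u. i \<in> I \<Longrightarrow> u \<in> U \<Longrightarrow> M i u \<in> rational_functions"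
  shows "\<exists>c. (\<forall>i\<in>I. c i \<in> rational_functions) \<and> (\<exists>i\<in>I. c i \<noteq> 0) \<and>
           (\<forall>u\<in>U. (\<Sum>i\<in>I. c i * M i u) = 0)"
  using assms
proof (induct U arbitrary: I M rule: finite_induct)
  case empty
  then have "I \<noteq> {}" by auto
  then show ?case
    by (intro exI[of _ "\<lambda>_. 1"]) (auto simp: one_in_rational_functions)
next
  case (insert v U)
  note K = add_in_rational_functions mult_in_rational_functions inverse_in_rational_functions
    uminus_in_rational_functions sum_in_rational_functions
  show ?case
  proof (cases "\<forall>i\<in>I. M i v = 0")
    case True
    have "card U < card I" using insert by simp
    then obtain c where "\<forall>i\<in>I. c i \<in> rational_functions" "\<exists>i\<in>I. c i \<noteq> 0"
      "\<forall>u\<in>U. (\<Sum>i\<in>I. c i * M i u) = 0"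
      using insert.hyps(3)[of I M] insert.prems by blast
    then show ?thesis using True by (intro exI[of _ c]) auto
  next
    case False
    then obtain j where j: "j \<in> I" "M j v \<noteq> 0" by blast
    \<comment> \<open>The equation for \<open>v\<close> is solved for the unknown \<open>j\<close> and substituted into the others.\<close>
    let ?I = "I - {j}"
    define q where "q i = M i v * inverse (M j v)" for i
    have q: "q i \<in> rational_functions" if "i \<in> I" for i
      unfolding q_def using that j insert.prems by (intro K) auto
    define N where "N i u = M i u + - (q i * M j u)" for i u
    have N: "N i u \<in> rational_functions" if "i \<in> ?I" "u \<in> U" for i u
      unfolding N_def using that j insert.prems q by (intro K) auto
    have "card U < card ?I"
      using insert.prems insert.hyps j by simp
    then obtain c where c: "\<forall>i\<in>?I. c i \<in> rational_functions" "\<exists>i\<in>?I. c i \<noteq> 0"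
      "\<forall>u\<in>U. (\<Sum>i\<in>?I. c i * N i u) = 0"
      using insert.hyps(3)[of ?I N] insert.prems N by auto
    define c' where "c' = c(j := - (\<Sum>i\<in>?I. c i * q i))"
    have "(\<Sum>i\<in>I. c' i * M i u) = (\<Sum>i\<in>?I. c i * N i u)" for u
    proof -
      have "(\<Sum>i\<in>I. c' i * M i u) = c' j * M j u + (\<Sum>i\<in>?I. c i * M i u)"
        using insert.prems j by (subst sum.remove[of _ j]) (auto simp: c'_def intro!: sum.cong)
      also have "\<dots> = (\<Sum>i\<in>?I. c i * M i u) - (\<Sum>i\<in>?I. c i * q i) * M j u"
        by (simp add: c'_def)
      also have "\<dots> = (\<Sum>i\<in>?I. c i * N i u)"
        by (simp add: N_def sum_distrib_right sum_subtractf ring_distribs mult.assoc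
            flip: diff_conv_add_uminus)
      finally show ?thesis .
    qed
    moreover have "(\<Sum>i\<in>?I. c i * N i v) = 0"
      using j by (simp add: N_def q_def mult.assoc)
    moreover have "\<forall>i\<in>I. c' i \<in> rational_functions"
      using c q by (auto simp: c'_def intro!: K)
    moreover have "\<exists>i\<in>I. c' i \<noteq> 0"
      using c by (auto simp: c'_def)
    ultimately show ?thesis
      using c(3) by (intro exI[of _ c']) auto
  qed
qed

section \<open>Finitely many sections imply algebraicity\<close>

text \<open>
  The Frobenius map acts as \<open>f(x)\<^sup>p = f(x\<^sup>p)\<close>, since coefficients in the prime field satisfy \<open>c\<^sup>p = c\<close>.
  Only finitely many coefficients of \<open>f\<close> influence the one in question, so the freshman's dream for
  finite sums applies after splitting off a remainder.
\<close>

lemma fps_power_card_nth: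
  fixes f :: "'p::prime_card mod_ring fps"
  shows "fps_nth (f ^ CARD('p)) k = (if CARD('p) dvd k then fps_nth f (k div CARD('p)) else 0)"
proof -
  define p where "p = CARD('p)"
  have p: "prime p" by (simp add: p_def prime_card)
  then have p0: "p > 0" by (simp add: prime_gt_0_nat)
  have char: "CHAR('p mod_ring fps) = p" by (simp add: p_def)
  define r where "r = fps_shift (Suc k) f"
  have "f = (\<Sum>i\<le>k. fps_const (fps_nth f i) * fps_X ^ i) + fps_X ^ Suc k * r"
  proof (rule fps_ext)
    fix n
    have "fps_nth (\<Sum>i\<le>k. fps_const (fps_nth f i) * fps_X ^ i) n
        = (\<Sum>i\<le>k. if n = i then fps_nth f i else 0)"
      by (simp add: fps_sum_nth fps_X_power_nth if_distrib cong: if_cong)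
    then show "fps_nth f n = fps_nth ((\<Sum>i\<le>k. fps_const (fps_nth f i) * fps_X ^ i) + fps_X ^ Suc k * r) n"
      by (simp add: r_def fps_X_power_mult_nth del: power_Suc)
  qed
  moreover have "(g + h) ^ p = g ^ p + h ^ p" for g h :: "'p mod_ring fps"
    using p char by (intro freshmans_dream) auto
  ultimately have "f ^ p = (\<Sum>i\<le>k. fps_const (fps_nth f i) * fps_X ^ i) ^ p + (fps_X ^ Suc k * r) ^ p"
    by metis
  also have "(\<Sum>i\<le>k. fps_const (fps_nth f i) * fps_X ^ i) ^ p
      = (\<Sum>i\<le>k. (fps_const (fps_nth f i) * fps_X ^ i) ^ p)"
    using p char by (intro freshmans_dream_sum) auto
  also have "\<dots> = (\<Sum>i\<le>k. fps_const (fps_nth f i) * fps_X ^ (i * p))"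
  proof (rule sum.cong)
    fix i
    have "fps_nth f i ^ p = fps_nth f i"
      using finite_field_power_card_eq_same[of "fps_nth f i"] by (simp add: p_def)
    then show "(fps_const (fps_nth f i) * fps_X ^ i) ^ p = fps_const (fps_nth f i) * fps_X ^ (i * p)"
      by (simp add: power_mult_distrib fps_const_power power_mult)
  qed simp
  also have "(fps_X ^ Suc k * r) ^ p = fps_X ^ (Suc k * p) * r ^ p"
    by (simp add: power_mult_distrib flip: power_mult del: power_Suc)
  finally have "fps_nth (f ^ p) k
      = (\<Sum>i\<le>k. fps_nth f i * (if k = i * p then 1 else 0)) + fps_nth (fps_X ^ (Suc k * p) * r ^ p) k"
    by (simp add: fps_sum_nth fps_X_power_nth)
  also have "fps_nth (fps_X ^ (Suc k * p) * r ^ p) k = 0"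
  proof -
    have "k < Suc k * p" using p0 by (cases p) auto
    then show ?thesis by (simp add: fps_X_power_mult_nth)
  qed
  also have "(\<Sum>i\<le>k. fps_nth f i * (if k = i * p then 1 else 0))
      = (if p dvd k then fps_nth f (k div p) else 0)"
  proof (cases "p dvd k")
    case True
    then have "k = i * p \<longleftrightarrow> i = k div p" for i using p0 by auto
    then have "(\<Sum>i\<le>k. fps_nth f i * (if k = i * p then 1 else 0))
        = (\<Sum>i\<le>k. if i = k div p then fps_nth f i else 0)"
      by (intro sum.cong) auto
    then show ?thesis using True by (simp add: div_le_dividend)
  next
    case False
    then have "k \<noteq> i * p" for i by auto
    then show ?thesis using False by simp
  qed
  finally show ?thesis by (simp add: p_def)
qed

text \<open>
The Cartier operators of characteristic \<open>p\<close>, indexed by the residue \<open>a\<close>.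
\<close>

definition cartier :: "nat \<Rightarrow> 'p::prime_card mod_ring fps \<Rightarrow> 'p mod_ring fps" where
  "cartier a f = Abs_fps (\<lambda>k. fps_nth f (a + CARD('p) * k))"

text \<open>
  The summand with index \<open>a\<close> is \<open>x\<^sup>a (\<Lambda>\<^sub>a f)(x\<^sup>p)\<close>, which collects the exponents congruent to \<open>a\<close>
  modulo \<open>p\<close>.
\<close>

lemma cartier_decomposition:
  fixes f :: "'p::prime_card mod_ring fps"
  shows "f = (\<Sum>a<CARD('p). fps_X ^ a * cartier a f ^ CARD('p))"
proof (rule fps_ext)
  fix k
  define p where "p = CARD('p)"
  have p0: "p > 0" by (simp add: p_def)
  have fps_power_card_nth': "fps_nth (g ^ p) j = (if p dvd j then fps_nth g (j div p) else 0)"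
    for g :: "'p mod_ring fps" and j
    using fps_power_card_nth[of g j] by (simp add: p_def)
  have "fps_nth (\<Sum>a<p. fps_X ^ a * cartier a f ^ p) k
      = (\<Sum>a<p. if a = k mod p then fps_nth f k else 0)"
    unfolding fps_sum_nth
  proof (rule sum.cong)
    fix a assume a: "a \<in> {..<p}"
    show "fps_nth (fps_X ^ a * cartier a f ^ p) k = (if a = k mod p then fps_nth f k else 0)"
    proof (cases "a = k mod p")
      case True
      then have "k - a = p * (k div p)" by (simp add: minus_mod_eq_mult_div)
      moreover have "\<not> k < a" using True by (simp add: not_less)
      ultimately show ?thesis
        using True p0
        by (simp add: fps_X_power_mult_nth fps_power_card_nth' cartier_def flip: p_def)
    next
      case False
      have "\<not> p dvd k - a" if "a \<le> k"
        using False a that mod_eq_dvd_iff_nat[of a k p] by auto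
      then show ?thesis
        using False by (simp add: fps_X_power_mult_nth fps_power_card_nth')
    qed
  qed simp
  also have "\<dots> = fps_nth f k" using p0 by simp
  finally show "fps_nth f k = fps_nth (\<Sum>a<CARD('p). fps_X ^ a * cartier a f ^ CARD('p)) k"
    by (simp add: p_def)
qed

definition power_span :: "nat \<Rightarrow> 'a::field fps set \<Rightarrow> 'a fls set" where
  "power_span n U =
     {\<Sum>u\<in>U. c u * fps_to_fls u ^ n | c. \<forall>u\<in>U. c u \<in> rational_functions}"

lemma power_span_base:
  assumes "finite U" "u \<in> U"
  shows "fps_to_fls u ^ n \<in> power_span n U"
proof -
  have "fps_to_fls u ^ n = (\<Sum>w\<in>U. (if w = u then 1 else 0) * fps_to_fls w ^ n)"
    using assms by (simp add: if_distrib[of "\<lambda>x. x * _"] cong: if_cong)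
  then show ?thesis
    unfolding power_span_def
    by (intro CollectI exI[of _ "\<lambda>w. if w = u then 1 else 0"])
      (auto simp: zero_in_rational_functions one_in_rational_functions)
qed

lemma power_span_sum_mult:
  assumes "\<And>a. a \<in> A \<Longrightarrow> y a \<in> power_span n U"
    and "\<And>a. a \<in> A \<Longrightarrow> x a \<in> rational_functions"
  shows "(\<Sum>a\<in>A. x a * y a) \<in> power_span n U"
proof -
  have "\<exists>c. \<forall>a\<in>A. y a = (\<Sum>u\<in>U. c a u * fps_to_fls u ^ n) \<and> (\<forall>u\<in>U. c a u \<in> rational_functions)"
    using assms(1) unfolding power_span_def by (intro bchoice) blast
  then obtain c where c: "\<And>a. a \<in> A \<Longrightarrow> y a = (\<Sum>u\<in>U. c a u * fps_to_fls u ^ n)"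
    "\<And>a u. a \<in> A \<Longrightarrow> u \<in> U \<Longrightarrow> c a u \<in> rational_functions"
    by blast
  have "(\<Sum>a\<in>A. x a * y a) = (\<Sum>a\<in>A. \<Sum>u\<in>U. x a * c a u * fps_to_fls u ^ n)"
    using c(1) by (simp add: sum_distrib_left mult.assoc)
  also have "\<dots> = (\<Sum>u\<in>U. (\<Sum>a\<in>A. x a * c a u) * fps_to_fls u ^ n)"
    by (subst sum.swap) (simp add: sum_distrib_right)
  finally show ?thesis
    unfolding power_span_def
    by (intro CollectI exI[of _ "\<lambda>u. \<Sum>a\<in>A. x a * c a u"])
      (auto intro!: sum_in_rational_functions mult_in_rational_functions assms(2) c(2))
qed

lemma fps_to_fls_sum: "fps_to_fls (\<Sum>i\<in>A. f i) = (\<Sum>i\<in>A. fps_to_fls (f i))"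
  by (induct A rule: infinite_finite_induct) auto

text \<open>
  Raising the Cartier decomposition of \<open>u\<close> to the power \<open>p\<^sup>s\<close> is additive and expresses \<open>u\<close> to the
  power \<open>p\<^sup>s\<close> by \<open>p\<^sup>s\<^sup>+\<^sup>1\<close>-th powers of its sections, which lie in \<open>U\<close> again. Descending from \<open>s = t\<close>,
  all lower powers land in the span of the \<open>p\<^sup>t\<close>-th powers.
\<close>

lemma power_in_power_span:
  fixes U :: "'p::prime_card mod_ring fps set"
  assumes U: "finite U" "\<And>u a. u \<in> U \<Longrightarrow> a < CARD('p) \<Longrightarrow> cartier a u \<in> U"
    and u: "u \<in> U" and "s \<le> t"
  shows "fps_to_fls u ^ (CARD('p) ^ s) \<in> power_span (CARD('p) ^ t) U"
  using \<open>s \<le> t\<close> u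
proof (induct s arbitrary: u rule: inc_induct)
  case base
  then show ?case using U(1) by (rule power_span_base[rotated])
next
  case (step s)
  define p where "p = CARD('p)"
  have p: "prime p" "CHAR('p mod_ring fps) = p" by (simp_all add: p_def prime_card)
  have "u ^ (p ^ s) = (\<Sum>a<p. fps_X ^ a * cartier a u ^ p) ^ (p ^ s)"
    unfolding p_def using cartier_decomposition[of u] by simp
  also have "\<dots> = (\<Sum>a<p. (fps_X ^ a * cartier a u ^ p) ^ (p ^ s))"
    using p by (intro freshmans_dream_sum') auto
  also have "\<dots> = (\<Sum>a<p. fps_X ^ (a * p ^ s) * cartier a u ^ (p ^ Suc s))"
    by (simp add: power_mult_distrib flip: power_mult)
  finally have "fps_to_fls u ^ (p ^ s)
      = (\<Sum>a<p. fps_to_fls (fps_X ^ (a * p ^ s)) * fps_to_fls (cartier a u) ^ (p ^ Suc s))"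
    by (simp add: fps_to_fls_sum fls_times_fps_to_fls flip: fps_to_fls_power)
  also have "\<dots> \<in> power_span (p ^ t) U"
    using step U(2) unfolding p_def
    by (intro power_span_sum_mult X_power_in_rational_functions) auto
  finally show ?case by (simp add: p_def)
qed

text \<open>
  This is the direction of Christol's theorem that yields algebraicity. With \<open>N\<close> the size of \<open>U\<close>,
  the \<open>N + 1\<close> powers of \<open>f\<close> with exponents \<open>1, p, \<dots>, p\<^sup>N\<close> all lie in a span of \<open>N\<close> elements over the
  rational functions. A linear relation between them is an additive polynomial with root \<open>f\<close>.
\<close>

lemma algebraic_if_finitely_many_sections:
  fixes U :: "'p::prime_card mod_ring fps set"
  assumes U: "finite U" "\<And>u a. u \<in> U \<Longrightarrow> a < CARD('p) \<Longrightarrow> cartier a u \<in> U"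
    and f: "f \<in> U"
  shows "algebraic_over rational_functions (fps_to_fls f)"
proof -
  define p where "p = CARD('p)"
  define N where "N = card U"
  have p1: "p > 1" using prime_gt_1_nat[OF prime_card[where 'a = 'p]] by (simp add: p_def)
  have "\<exists>M. \<forall>s\<in>{..N}. fps_to_fls f ^ (p ^ s) = (\<Sum>u\<in>U. M s u * fps_to_fls u ^ (p ^ N)) \<and>
      (\<forall>u\<in>U. M s u \<in> rational_functions)"
    using power_in_power_span[OF U f, of _ N] unfolding power_span_def p_def
    by (intro bchoice) blast
  then obtain M where M: "\<And>s. s \<le> N \<Longrightarrow> fps_to_fls f ^ (p ^ s) = (\<Sum>u\<in>U. M s u * fps_to_fls u ^ (p ^ N))"
    "\<And>s u. s \<le> N \<Longrightarrow> u \<in> U \<Longrightarrow> M s u \<in> rational_functions"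
    by auto
  obtain c where c: "\<forall>s\<in>{..N}. c s \<in> rational_functions" "\<exists>s\<in>{..N}. c s \<noteq> 0"
    "\<forall>u\<in>U. (\<Sum>s\<le>N. c s * M s u) = 0"
    using homogeneous_system_over_rational_functions[of U "{..N}" M] U(1) M(2)
    by (auto simp: N_def)
  define P where "P = (\<Sum>s\<le>N. Polynomial.monom (c s) (p ^ s))"
  have coeff_P: "Polynomial.coeff P i = (\<Sum>s\<le>N. if p ^ s = i then c s else 0)" for i
    by (simp add: P_def coeff_sum)
  have "\<forall>i. Polynomial.coeff P i \<in> rational_functions"
    unfolding coeff_P using c(1)
    by (auto intro!: sum_in_rational_functions simp: zero_in_rational_functions)
  moreover have "P \<noteq> 0"
  proof -
    obtain s where s: "s \<le> N" "c s \<noteq> 0" using c(2) by auto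
    have "Polynomial.coeff P (p ^ s) = c s"
      unfolding coeff_P using p1 s(1) by (simp add: power_inject_exp)
    then show ?thesis using s(2) by auto
  qed
  moreover have "poly P (fps_to_fls f) = 0"
  proof -
    have "poly P (fps_to_fls f) = (\<Sum>s\<le>N. c s * fps_to_fls f ^ (p ^ s))"
      by (simp add: P_def poly_sum poly_monom)
    also have "\<dots> = (\<Sum>s\<le>N. \<Sum>u\<in>U. c s * M s u * fps_to_fls u ^ (p ^ N))"
      using M(1) by (simp add: sum_distrib_left mult.assoc)
    also have "\<dots> = (\<Sum>u\<in>U. (\<Sum>s\<le>N. c s * M s u) * fps_to_fls u ^ (p ^ N))"
      by (subst sum.swap) (simp add: sum_distrib_right)
    also have "\<dots> = 0" using c(3) by simp
    finally show ?thesis .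
  qed
  ultimately show ?thesis
    unfolding algebraic_over_def by blast
qed

lemma algebraic_if_eventually_zero:
  fixes f :: "'a::field fps"
  assumes "\<And>k. k \<ge> n \<Longrightarrow> fps_nth f k = 0"
  shows "algebraic_over rational_functions (fps_to_fls f)"
proof -
  define g where "g = (\<Sum>i<n. Polynomial.monom (fps_nth f i) i)"
  have "f = fps_of_poly g"
    using assms by (intro fps_ext) (auto simp: g_def coeff_sum)
  then have "fps_to_fls f \<in> rational_functions"
    using rational_functionsI_poly by simp
  then show ?thesis
    unfolding algebraic_over_def
    by (intro exI[of _ "[:- fps_to_fls f, 1:]"])
      (auto simp: coeff_pCons uminus_in_rational_functions zero_in_rational_functions
        one_in_rational_functions split: nat.split)
qed

section \<open>Leading terms of rational numbers\<close>

text \<open>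
  Instead of a \<open>p\<close>-adic expansion, only the valuation \<open>v\<close> and the first nonzero digit \<open>u\<close> of \<open>x\<close> are
  recorded. The prime is carried by the type of \<open>u\<close>.
\<close>

definition leading_term :: "rat \<Rightarrow> int \<Rightarrow> 'p::prime_card mod_ring \<Rightarrow> bool" where
  "leading_term x v u \<longleftrightarrow> (\<exists>a b. \<not> int CARD('p) dvd a \<and> \<not> int CARD('p) dvd b \<and>
     x = of_nat CARD('p) powi v * (of_int a / of_int b) \<and> u = of_int a / of_int b)"

lemma of_int_mod_ring_eq_0_iff:
  "of_int a = (0 :: 'p::prime_card mod_ring) \<longleftrightarrow> int CARD('p) dvd a"
  by (simp add: of_int_eq_0_iff_char_dvd)

lemma leading_term_exists:
  assumes "x \<noteq> 0"
  shows "\<exists>v (u :: 'p::prime_card mod_ring). leading_term x v u"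
proof -
  define p where "p = int CARD('p)"
  have p: "prime p" by (simp add: p_def prime_card)
  obtain a b where ab: "x = of_int a / of_int b" "b \<noteq> 0"
    by (metis quotient_of_div quotient_of_denom_pos' less_irrefl prod.collapse)
  with assms have "a \<noteq> 0" by auto
  have "\<not> is_unit p" using p not_prime_unit by blast
  obtain a' where a': "a = p ^ multiplicity p a * a'" "\<not> p dvd a'"
    using multiplicity_decompose'[OF \<open>a \<noteq> 0\<close> \<open>\<not> is_unit p\<close>] .
  obtain b' where b': "b = p ^ multiplicity p b * b'" "\<not> p dvd b'"
    using multiplicity_decompose'[OF \<open>b \<noteq> 0\<close> \<open>\<not> is_unit p\<close>] .
  have p0: "rat_of_int p \<noteq> 0" using p by auto
  have "x = (rat_of_int p ^ multiplicity p a * of_int a') / (of_int p ^ multiplicity p b * of_int b')"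
    unfolding ab(1) by (subst a'(1), subst b'(1)) simp
  also have "\<dots> = rat_of_int p powi (int (multiplicity p a) - int (multiplicity p b)) * (of_int a' / of_int b')"
    using p0 by (simp add: power_int_diff)
  finally have "leading_term x (int (multiplicity p a) - int (multiplicity p b))
      (of_int a' / of_int b' :: 'p mod_ring)"
    unfolding leading_term_def using a'(2) b'(2)
    by (intro exI[of _ a'] exI[of _ b']) (simp add: p_def)
  then show ?thesis by blast
qed

lemma leading_term_unique_aux:
  fixes u u' :: "'p::prime_card mod_ring"
  assumes "leading_term x v u" "leading_term x v' u'" "v \<le> v'"
  shows "v = v' \<and> u = u'"
proof -
  define p where "p = int CARD('p)"
  have p: "prime p" by (simp add: p_def prime_card)
  obtain a b where ab: "\<not> p dvd a" "\<not> p dvd b" "x = of_int p powi v * (of_int a / of_int b)"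
    "u = of_int a / of_int b"
    using assms(1) by (auto simp: leading_term_def p_def)
  obtain a' b' where ab': "\<not> p dvd a'" "\<not> p dvd b'" "x = of_int p powi v' * (of_int a' / of_int b')"
    "u' = of_int a' / of_int b'"
    using assms(2) by (auto simp: leading_term_def p_def)
  define n where "n = nat (v' - v)"
  have v': "v' = v + int n" using assms(3) by (simp add: n_def)
  have p0: "rat_of_int p \<noteq> 0" using p by auto
  have b0: "b \<noteq> 0" "b' \<noteq> 0" using ab ab' by auto
  have "rat_of_int p powi v * (of_int a / of_int b)
      = of_int p powi v * (of_int p ^ n * (of_int a' / of_int b'))"
    using ab(3) ab'(3) p0 by (simp add: v' power_int_add)
  then have "rat_of_int a / of_int b = of_int p ^ n * (of_int a' / of_int b')"
    using power_int_not_zero[of "rat_of_int p" v] p0 by (metis mult_left_cancel)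
  then have "rat_of_int (a * b') = of_int (p ^ n * a' * b)"
    using b0 by (simp add: field_simps)
  then have eq: "a * b' = p ^ n * a' * b" by (simp only: of_int_eq_iff)
  have "n = 0"
  proof (rule ccontr)
    assume "n \<noteq> 0"
    then have "p dvd a * b'" unfolding eq by (cases n) auto
    then show False using p ab ab' by (simp add: prime_dvd_mult_iff)
  qed
  then have "a * b' = a' * b" using eq by simp
  then have "(of_int a * of_int b' :: 'p mod_ring) = of_int a' * of_int b"
    by (metis of_int_mult)
  then have "u = u'"
    using ab ab' by (simp add: frac_eq_eq of_int_mod_ring_eq_0_iff p_def)
  with \<open>n = 0\<close> show ?thesis by (simp add: v')
qed

lemma leading_term_unique:
  fixes u u' :: "'p::prime_card mod_ring"
  assumes "leading_term x v u" "leading_term x v' u'"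
  shows "v = v'" "u = u'"
  using leading_term_unique_aux[OF assms] leading_term_unique_aux[OF assms(2,1)] by linarith+

text \<open>
  \<^term>\<open>pval TYPE('p) x\<close> is the \<open>p\<close>-adic valuation and \<^term>\<open>ac x\<close> the angular component of \<open>x\<close>.
  Both are meaningful for \<open>x \<noteq> 0\<close>.
\<close>

definition pval :: "'p::prime_card itself \<Rightarrow> rat \<Rightarrow> int" where
  "pval _ x = (THE v. \<exists>u :: 'p mod_ring. leading_term x v u)"

definition ac :: "rat \<Rightarrow> 'p::prime_card mod_ring" where
  "ac x = (THE u. \<exists>v. leading_term x v u)"

lemma leading_term_imp:
  fixes u :: "'p::prime_card mod_ring"
  assumes "leading_term x v u"
  shows "pval TYPE('p) x = v" "ac x = u"
  unfolding pval_def ac_def using assms leading_term_unique by blast+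

lemma leading_term_pval_ac:
  assumes "x \<noteq> 0"
  shows "leading_term x (pval TYPE('p::prime_card) x) (ac x :: 'p mod_ring)"
  using leading_term_exists[OF assms, where 'p = 'p] leading_term_imp by metis

lemma leading_term_mult:
  fixes u u' :: "'p::prime_card mod_ring"
  assumes "leading_term x v u" "leading_term y v' u'"
  shows "leading_term (x * y) (v + v') (u * u')"
proof -
  define p where "p = int CARD('p)"
  have p: "prime p" by (simp add: p_def prime_card)
  then have p0: "rat_of_int p \<noteq> 0" by auto
  obtain a b where ab: "\<not> p dvd a" "\<not> p dvd b" "x = of_int p powi v * (of_int a / of_int b)"
    "u = of_int a / of_int b"
    using assms(1) by (auto simp: leading_term_def p_def)
  obtain a' b' where ab': "\<not> p dvd a'" "\<not> p dvd b'" "y = of_int p powi v' * (of_int a' / of_int b')"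
    "u' = of_int a' / of_int b'"
    using assms(2) by (auto simp: leading_term_def p_def)
  have "\<not> p dvd a * a'" "\<not> p dvd b * b'"
    using p ab ab' by (auto simp: prime_dvd_mult_iff)
  moreover have "x * y = of_int p powi (v + v') * (of_int (a * a') / of_int (b * b'))"
    using p0 by (simp add: ab(3) ab'(3) power_int_add)
  ultimately show ?thesis
    unfolding leading_term_def ab(4) ab'(4)
    by (intro exI[of _ "a * a'"] exI[of _ "b * b'"]) (simp add: p_def)
qed

lemma leading_term_inverse:
  fixes u :: "'p::prime_card mod_ring"
  assumes "leading_term x v u"
  shows "leading_term (inverse x) (- v) (inverse u)"
proof -
  obtain a b where ab: "\<not> int CARD('p) dvd a" "\<not> int CARD('p) dvd b"
    and x: "x = of_nat CARD('p) powi v * (of_int a / of_int b)" and u: "u = of_int a / of_int b"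
    using assms by (auto simp: leading_term_def)
  have "inverse x = of_nat CARD('p) powi (- v) * (of_int b / of_int a)"
    unfolding x by (simp add: power_int_minus field_simps)
  moreover have "inverse u = of_int b / of_int a" unfolding u by simp
  ultimately show ?thesis
    unfolding leading_term_def using ab by blast
qed

lemma
  assumes "x \<noteq> 0" "y \<noteq> 0"
  shows pval_mult: "pval TYPE('p::prime_card) (x * y) = pval TYPE('p) x + pval TYPE('p) y"
    and ac_mult: "(ac (x * y) :: 'p mod_ring) = ac x * ac y"
  using leading_term_imp[OF leading_term_mult[OF leading_term_pval_ac leading_term_pval_ac]] assms
  by blast+

lemma
  assumes "x \<noteq> 0"
  shows pval_inverse: "pval TYPE('p::prime_card) (inverse x) = - pval TYPE('p) x"
    and ac_inverse: "(ac (inverse x) :: 'p mod_ring) = inverse (ac x)"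
  using leading_term_imp[OF leading_term_inverse[OF leading_term_pval_ac]] assms
  by blast+

lemma leading_term_fraction:
  assumes "\<not> int CARD('p) dvd a" "\<not> int CARD('p) dvd b"
  shows "leading_term (of_int a / of_int b) 0 (of_int a / of_int b :: 'p::prime_card mod_ring)"
  unfolding leading_term_def using assms by (intro exI[of _ a] exI[of _ b]) simp

lemma leading_term_prime:
  "leading_term (of_nat CARD('p)) 1 (1 :: 'p::prime_card mod_ring)"
proof -
  have "\<not> int CARD('p) dvd 1"
    using prime_card_int[where 'a = 'p] not_prime_unit by blast
  then show ?thesis
    unfolding leading_term_def by (intro exI[of _ 1]) simp
qed

lemma leading_term_one: "leading_term 1 0 (1 :: 'p::prime_card mod_ring)"
proof -
  have "\<not> int CARD('p) dvd 1"
    using prime_card_int[where 'a = 'p] not_prime_unit by blast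
  then show ?thesis
    unfolding leading_term_def by (intro exI[of _ 1]) simp
qed

lemma
  assumes "x \<in> localization CARD('p::prime_card)" "x \<noteq> 0"
  shows pval_localization: "pval TYPE('p) x \<ge> 0"
    and rat_mod_eq_ac: "(rat_mod x :: 'p mod_ring) = (if pval TYPE('p) x = 0 then ac x else 0)"
proof -
  define p where "p = int CARD('p)"
  have p: "prime p" by (simp add: p_def prime_card)
  then have unit: "\<not> is_unit p" using not_prime_unit by blast
  obtain a b where q: "quotient_of x = (a, b)" by (cases "quotient_of x")
  have x: "x = of_int a / of_int b" using q by (rule quotient_of_div)
  then have "a \<noteq> 0" using assms(2) by auto
  have "coprime b p" using assms(1) q by (simp add: localization_def p_def)
  then have b: "\<not> p dvd b" using unit coprime_absorb_right by blast
  have mod: "(rat_mod x :: 'p mod_ring) = of_int a / of_int b" by (simp add: rat_mod_def q)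
  obtain a' where a': "a = p ^ multiplicity p a * a'" "\<not> p dvd a'"
    using multiplicity_decompose'[OF \<open>a \<noteq> 0\<close> unit] .
  have "x = rat_of_int p powi int (multiplicity p a) * (of_int a' / of_int b)"
    unfolding x by (subst a'(1)) simp
  then have "leading_term x (int (multiplicity p a)) (of_int a' / of_int b :: 'p mod_ring)"
    unfolding leading_term_def using a' b
    by (intro exI[of _ a'] exI[of _ b]) (simp add: p_def)
  note L = leading_term_imp[OF this]
  show "pval TYPE('p) x \<ge> 0" using L by simp
  show "(rat_mod x :: 'p mod_ring) = (if pval TYPE('p) x = 0 then ac x else 0)"
  proof (cases "multiplicity p a = 0")
    case True
    then have "a = a'" using a' by simp
    then show ?thesis using L True mod by simp
  next
    case False
    then have "p dvd a" using a'(1) dvd_power by (metis dvd_mult2 neq0_conv)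
    then have "(of_int a :: 'p mod_ring) = 0" by (simp add: of_int_mod_ring_eq_0_iff p_def)
    then show ?thesis using L False mod by simp
  qed
qed

section \<open>Self-similar families of sequences\<close>

text \<open>
  Two sequences related in this way have the same behaviour modulo \<open>p\<close> up to a geometric factor: their
  valuations differ by an affine function of slope \<open>d\<close>, and their angular components by a geometric
  progression. The slope is a parameter because it decides between the two cases of the proof.
\<close>

definition twist :: "'p::prime_card itself \<Rightarrow> int \<Rightarrow> (nat \<Rightarrow> rat) \<Rightarrow> (nat \<Rightarrow> rat) \<Rightarrow> bool" where
  "twist _ d w w' \<longleftrightarrow> (\<exists>e (C :: 'p mod_ring) D. \<forall>l.
     pval TYPE('p) (w l) = e + d * int l + pval TYPE('p) (w' l) \<and>
     ac (w l) = C * D ^ l * ac (w' l))"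

lemma twistI:
  assumes "\<And>l. pval TYPE('p::prime_card) (w l) = e + d * int l + pval TYPE('p) (w' l)"
    and "\<And>l. (ac (w l) :: 'p mod_ring) = C * D ^ l * ac (w' l)"
  shows "twist TYPE('p) d w w'"
  unfolding twist_def using assms by blast

lemma twistE:
  assumes "twist TYPE('p::prime_card) d w w'"
  obtains e and C D :: "'p::prime_card mod_ring"
  where "\<And>l. pval TYPE('p) (w l) = e + d * int l + pval TYPE('p) (w' l)"
    and "\<And>l. ac (w l) = C * D ^ l * ac (w' l)"
  using assms unfolding twist_def by blast

lemma twist_refl: "twist TYPE('p::prime_card) 0 w w"
  by (rule twistI[where e = 0 and C = 1 and D = 1]) simp_all

lemma twist_trans:
  assumes "twist TYPE('p::prime_card) d w w'" "twist TYPE('p) d' w' w''"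
  shows "twist TYPE('p) (d + d') w w''"
proof -
  obtain e and C D :: "'p mod_ring" where 1:
    "\<And>l. pval TYPE('p) (w l) = e + d * int l + pval TYPE('p) (w' l)"
    "\<And>l. ac (w l) = C * D ^ l * ac (w' l)"
    using assms(1) by (rule twistE) blast
  obtain e' and C' D' :: "'p mod_ring" where 2:
    "\<And>l. pval TYPE('p) (w' l) = e' + d' * int l + pval TYPE('p) (w'' l)"
    "\<And>l. ac (w' l) = C' * D' ^ l * ac (w'' l)"
    using assms(2) by (rule twistE) blast
  show ?thesis
    by (rule twistI[where e = "e + e'" and C = "C * C'" and D = "D * D'"])
      (simp_all add: 1 2 algebra_simps power_mult_distrib)
qed

lemma twist_arith_prog:
  assumes "twist TYPE('p::prime_card) d w w'"
  shows "twist TYPE('p) (d * int q) (\<lambda>l. w (a + q * l)) (\<lambda>l. w' (a + q * l))"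
proof -
  obtain e and C D :: "'p mod_ring" where 1:
    "\<And>l. pval TYPE('p) (w l) = e + d * int l + pval TYPE('p) (w' l)"
    "\<And>l. ac (w l) = C * D ^ l * ac (w' l)"
    using assms(1) by (rule twistE) blast
  show ?thesis
    by (rule twistI[where e = "e + d * int a" and C = "C * D ^ a" and D = "D ^ q"])
      (simp_all add: 1 algebra_simps power_add flip: power_mult)
qed

lemma twist_mult:
  assumes "twist TYPE('p::prime_card) d v v'" "twist TYPE('p) d' w w'"
    and "\<And>l. v l \<noteq> 0" "\<And>l. v' l \<noteq> 0" "\<And>l. w l \<noteq> 0" "\<And>l. w' l \<noteq> 0"
  shows "twist TYPE('p) (d + d') (\<lambda>l. v l * w l) (\<lambda>l. v' l * w' l)"
proof -
  obtain e and C D :: "'p mod_ring" where 1: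
    "\<And>l. pval TYPE('p) (v l) = e + d * int l + pval TYPE('p) (v' l)"
    "\<And>l. ac (v l) = C * D ^ l * ac (v' l)"
    using assms(1) by (rule twistE) blast
  obtain e' and C' D' :: "'p mod_ring" where 2:
    "\<And>l. pval TYPE('p) (w l) = e' + d' * int l + pval TYPE('p) (w' l)"
    "\<And>l. ac (w l) = C' * D' ^ l * ac (w' l)"
    using assms(2) by (rule twistE) blast
  show ?thesis
    by (rule twistI[where e = "e + e'" and C = "C * C'" and D = "D * D'"])
      (simp_all add: 1 2 pval_mult ac_mult assms(3-) algebra_simps power_mult_distrib)
qed

lemma twist_inverse:
  assumes "twist TYPE('p::prime_card) d w w'"
    and "\<And>l. w l \<noteq> 0" "\<And>l. w' l \<noteq> 0"
  shows "twist TYPE('p) (- d) (\<lambda>l. inverse (w l)) (\<lambda>l. inverse (w' l))"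
proof -
  obtain e and C D :: "'p mod_ring" where 1:
    "\<And>l. pval TYPE('p) (w l) = e + d * int l + pval TYPE('p) (w' l)"
    "\<And>l. ac (w l) = C * D ^ l * ac (w' l)"
    using assms(1) by (rule twistE) blast
  show ?thesis
    by (rule twistI[where e = "- e" and C = "inverse C" and D = "inverse D"])
      (simp_all add: 1 pval_inverse ac_inverse assms(2-) power_inverse)
qed

text \<open>
  Up to twists of one common slope \<open>d\<close>, the finite set \<open>S\<close> is closed under passing to the subsequences
  along residue classes modulo \<open>p\<close>.
\<close>

definition self_similar :: "'p::prime_card itself \<Rightarrow> int \<Rightarrow> (nat \<Rightarrow> rat) set \<Rightarrow> bool" where
  "self_similar _ d S \<longleftrightarrow> finite S \<and> (\<forall>w\<in>S. \<forall>l. w l \<noteq> 0) \<and>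
     (\<forall>w\<in>S. \<forall>a<CARD('p). \<exists>w'\<in>S. twist TYPE('p) d (\<lambda>l. w (a + CARD('p) * l)) w')"

lemma self_similar_one: "self_similar TYPE('p::prime_card) 0 {\<lambda>_. 1}"
  by (simp add: self_similar_def twist_refl)

lemma self_similar_mult:
  assumes "self_similar TYPE('p::prime_card) d S" "self_similar TYPE('p) d' S'"
  shows "self_similar TYPE('p) (d + d') ((\<lambda>(v, w) l. v l * w l) ` (S \<times> S'))"
  unfolding self_similar_def
proof (intro conjI ballI allI impI)
  show "finite ((\<lambda>(v, w) l. v l * w l) ` (S \<times> S'))"
    using assms by (simp add: self_similar_def)
  fix u assume "u \<in> (\<lambda>(v, w) l. v l * w l) ` (S \<times> S')"
  then obtain v w where vw: "v \<in> S" "w \<in> S'" "u = (\<lambda>l. v l * w l)" by auto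
  show "u l \<noteq> 0" for l using vw assms by (simp add: self_similar_def)
  fix a assume "a < CARD('p)"
  then obtain v' w' where v'w': "v' \<in> S" "twist TYPE('p) d (\<lambda>l. v (a + CARD('p) * l)) v'"
    "w' \<in> S'" "twist TYPE('p) d' (\<lambda>l. w (a + CARD('p) * l)) w'"
    using vw(1,2) assms unfolding self_similar_def by metis
  then have "twist TYPE('p) (d + d') (\<lambda>l. u (a + CARD('p) * l)) (\<lambda>l. v' l * w' l)"
    unfolding vw(3) using vw assms by (intro twist_mult) (auto simp: self_similar_def)
  then show "\<exists>u'\<in>(\<lambda>(v, w) l. v l * w l) ` (S \<times> S').
      twist TYPE('p) (d + d') (\<lambda>l. u (a + CARD('p) * l)) u'"
    using v'w' by (intro bexI[of _ "\<lambda>l. v' l * w' l"]) auto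
qed

lemma self_similar_inverse:
  assumes "self_similar TYPE('p::prime_card) d S"
  shows "self_similar TYPE('p) (- d) ((\<lambda>w l. inverse (w l)) ` S)"
  unfolding self_similar_def
proof (intro conjI ballI allI impI)
  show "finite ((\<lambda>w l. inverse (w l)) ` S)"
    using assms by (simp add: self_similar_def)
  fix u assume "u \<in> (\<lambda>w l. inverse (w l)) ` S"
  then obtain w where w: "w \<in> S" "u = (\<lambda>l. inverse (w l))" by auto
  show "u l \<noteq> 0" for l using w assms by (simp add: self_similar_def)
  fix a assume "a < CARD('p)"
  then obtain w' where w': "w' \<in> S" "twist TYPE('p) d (\<lambda>l. w (a + CARD('p) * l)) w'"
    using w(1) assms unfolding self_similar_def by metis
  then have "twist TYPE('p) (- d) (\<lambda>l. u (a + CARD('p) * l)) (\<lambda>l. inverse (w' l))"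
    unfolding w(2) using w assms by (intro twist_inverse) (auto simp: self_similar_def)
  then show "\<exists>u'\<in>(\<lambda>w l. inverse (w l)) ` S. twist TYPE('p) (- d) (\<lambda>l. u (a + CARD('p) * l)) u'"
    using w' by (intro bexI[of _ "\<lambda>l. inverse (w' l)"]) auto
qed

lemma self_similar_prod:
  assumes "finite I"
    and "\<And>i. i \<in> I \<Longrightarrow> \<exists>d S. self_similar TYPE('p::prime_card) d S \<and> w i \<in> S"
  shows "\<exists>d S. self_similar TYPE('p) d S \<and> (\<lambda>k. \<Prod>i\<in>I. w i k) \<in> S"
  using assms
proof (induct I rule: finite_induct)
  case empty
  show ?case
    by (intro exI[of _ 0] exI[of _ "{\<lambda>_. 1}"]) (simp add: self_similar_one)
next
  case (insert i I)
  then obtain d S d' S' where "self_similar TYPE('p) d S" "w i \<in> S"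
    "self_similar TYPE('p) d' S'" "(\<lambda>k. \<Prod>i\<in>I. w i k) \<in> S'"
    by (metis insertCI)
  then show ?case
    using insert.hyps
    by (intro exI[of _ "d + d'"] exI[of _ "(\<lambda>(v, w) l. v l * w l) ` (S \<times> S')"] conjI
        self_similar_mult image_eqI[of _ _ "(w i, \<lambda>k. \<Prod>i\<in>I. w i k)"]) auto
qed

section \<open>Reduction of self-similar sequences\<close>

definition twisted_reduction :: "int \<Rightarrow> 'p::prime_card mod_ring \<Rightarrow> 'p mod_ring \<Rightarrow> (nat \<Rightarrow> rat) \<Rightarrow> 'p mod_ring fps" where
  "twisted_reduction e C D w =
     Abs_fps (\<lambda>l. if e + pval TYPE('p) (w l) = 0 then C * D ^ l * ac (w l) else 0)"

text \<open>
  The nonnegativity condition makes the twisted sequence \<open>p\<close>-integral, so that its members are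
  genuine reductions modulo \<open>p\<close>.
\<close>

definition twisted_reductions :: "(nat \<Rightarrow> rat) set \<Rightarrow> 'p::prime_card mod_ring fps set" where
  "twisted_reductions S =
     {twisted_reduction e C D w | e C D w. w \<in> S \<and> (\<forall>l. e + pval TYPE('p) (w l) \<ge> 0)}"

text \<open>
  The shift \<open>e\<close> ranges over an infinite set, but a nonzero reduction forces \<open>e\<close> to be the negative of
  the minimal valuation of \<open>w\<close>: a smaller shift is not integral, a larger one reduces to zero.
\<close>

lemma finite_twisted_reductions:
  assumes "finite S"
  shows "finite (twisted_reductions S :: 'p::prime_card mod_ring fps set)"
proof -
  define m where "m w = (SOME e. (\<forall>l. e + pval TYPE('p) (w l) \<ge> 0) \<and> (\<exists>l. e + pval TYPE('p) (w l) = 0))"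
    for w :: "nat \<Rightarrow> rat"
  have "twisted_reductions S \<subseteq>
      insert 0 ((\<lambda>(w, C :: 'p mod_ring, D). twisted_reduction (m w) C D w) ` (S \<times> UNIV \<times> UNIV))"
  proof
    fix g :: "'p mod_ring fps"
    assume "g \<in> twisted_reductions S"
    then obtain e C D w where g: "g = twisted_reduction e C D w" "w \<in> S"
      "\<And>l. e + pval TYPE('p) (w l) \<ge> 0"
      by (auto simp: twisted_reductions_def)
    show "g \<in> insert 0 ((\<lambda>(w, C :: 'p mod_ring, D). twisted_reduction (m w) C D w) ` (S \<times> UNIV \<times> UNIV))"
    proof (cases "\<exists>l. e + pval TYPE('p) (w l) = 0")
      case True
      have "m w = e"
        unfolding m_def
      proof (rule some_equality)
        fix e' assume e': "(\<forall>l. e' + pval TYPE('p) (w l) \<ge> 0) \<and> (\<exists>l. e' + pval TYPE('p) (w l) = 0)"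
        obtain l l' where "e + pval TYPE('p) (w l) = 0" "e' + pval TYPE('p) (w l') = 0"
          using True e' by blast
        moreover have "e' + pval TYPE('p) (w l) \<ge> 0" "e + pval TYPE('p) (w l') \<ge> 0"
          using e' g(3) by auto
        ultimately show "e' = e" by linarith
      qed (use g(3) True in blast)
      then show ?thesis using g by (intro insertI2 image_eqI[of _ _ "(w, C, D)"]) auto
    next
      case False
      then have "g = 0" by (simp add: g(1) twisted_reduction_def fps_eq_iff)
      then show ?thesis by simp
    qed
  qed
  then show ?thesis
    by (rule finite_subset) (simp add: assms)
qed

lemma cartier_twisted_reductions:
  assumes "self_similar TYPE('p::prime_card) 0 S" "g \<in> twisted_reductions S" "a < CARD('p)"
  shows "cartier a (g :: 'p mod_ring fps) \<in> twisted_reductions S"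
proof -
  obtain e C D w where g: "g = twisted_reduction e C D w" "w \<in> S"
    "\<And>l. e + pval TYPE('p) (w l) \<ge> 0"
    using assms(2) by (auto simp: twisted_reductions_def)
  obtain w' where w': "w' \<in> S" "twist TYPE('p) 0 (\<lambda>l. w (a + CARD('p) * l)) w'"
    using assms(1,3) g(2) unfolding self_similar_def by metis
  obtain e' and C' D' :: "'p mod_ring" where 1:
    "\<And>l. pval TYPE('p) (w (a + CARD('p) * l)) = e' + 0 * int l + pval TYPE('p) (w' l)"
    "\<And>l. ac (w (a + CARD('p) * l)) = C' * D' ^ l * ac (w' l)"
    using w'(2) by (rule twistE) blast
  have "cartier a g = twisted_reduction (e + e') (C * D ^ a * C') (D ^ CARD('p) * D') w'"
  proof (rule fps_ext)
    fix l
    have "D ^ (a + CARD('p) * l) = D ^ a * (D ^ CARD('p)) ^ l"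
      by (simp only: power_add power_mult)
    then have "C * D ^ (a + CARD('p) * l) * (C' * D' ^ l * ac (w' l))
        = C * D ^ a * C' * (D ^ CARD('p) * D') ^ l * ac (w' l)"
      by (simp only: power_mult_distrib mult_ac)
    then show "fps_nth (cartier a g) l
        = fps_nth (twisted_reduction (e + e') (C * D ^ a * C') (D ^ CARD('p) * D') w') l"
      unfolding g(1) cartier_def twisted_reduction_def fps_nth_Abs_fps 1 by (simp add: add.assoc)
  qed
  moreover have "e + e' + pval TYPE('p) (w' l) \<ge> 0" for l
    using g(3)[of "a + CARD('p) * l"] by (simp add: 1)
  ultimately show ?thesis
    unfolding twisted_reductions_def using w'(1) by blast
qed

text \<open>
  Iterating the section along the \<open>t\<close> base-\<open>p\<close> digits of \<open>c\<close>. A section multiplies the slope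
  collected so far by \<open>p\<close>, since \<open>l\<close> is replaced by \<open>a + p l\<close>, and adds \<open>d\<close>.
\<close>

lemma self_similar_digits:
  assumes S: "self_similar TYPE('p::prime_card) d S" "w \<in> S"
    and "c < CARD('p) ^ t"
  shows "\<exists>w'\<in>S. twist TYPE('p) (d * (\<Sum>i<t. int CARD('p) ^ i)) (\<lambda>l. w (c + CARD('p) ^ t * l)) w'"
  using assms(3)
proof (induct t arbitrary: c)
  case 0
  then show ?case using S(2) twist_refl[of w] by (intro bexI[of _ w]) auto
next
  case (Suc t)
  define p where "p = CARD('p)"
  have p0: "p > 0" by (simp add: p_def)
  define b where "b = c mod p ^ t"
  define a where "a = c div p ^ t"
  have a: "a < p" using Suc.prems p0 by (simp add: a_def less_mult_imp_div_less flip: p_def)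
  have "b < CARD('p) ^ t" using p0 by (simp add: b_def flip: p_def)
  then obtain v where v: "v \<in> S"
    "twist TYPE('p) (d * (\<Sum>i<t. int CARD('p) ^ i)) (\<lambda>l. w (b + CARD('p) ^ t * l)) v"
    using Suc.hyps by blast
  obtain w' where w': "w' \<in> S" "twist TYPE('p) d (\<lambda>l. v (a + CARD('p) * l)) w'"
    using S(1) v(1) a unfolding p_def self_similar_def by metis
  have "twist TYPE('p) (d * (\<Sum>i<t. int p ^ i) * int p + d)
      (\<lambda>l. w (b + p ^ t * (a + p * l))) w'"
    using twist_trans[OF twist_arith_prog[OF v(2), where q = p and a = a] w'(2)[folded p_def]]
    by (simp add: p_def)
  also have "d * (\<Sum>i<t. int p ^ i) * int p + d = d * (\<Sum>i<Suc t. int p ^ i)"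
    by (subst sum.lessThan_Suc_shift) (simp add: sum_distrib_right sum_distrib_left algebra_simps)
  also have "(\<lambda>l. w (b + p ^ t * (a + p * l))) = (\<lambda>l. w (c + p ^ Suc t * l))"
  proof
    fix l
    have "b + p ^ t * (a + p * l) = (p ^ t * a + b) + p ^ Suc t * l"
      by (simp add: algebra_simps)
    then show "w (b + p ^ t * (a + p * l)) = w (c + p ^ Suc t * l)"
      by (simp add: a_def b_def)
  qed
  finally show ?case using w'(1) by (auto simp: p_def)
qed

text \<open>
  The valuations of \<open>w\<^sub>2\<close> exceed those of \<open>w\<^sub>1\<close>, which are nonnegative, by an affine function of
  positive slope.
\<close>

lemma twist_pos_pval:
  assumes "twist TYPE('p::prime_card) d1 w1 w" "twist TYPE('p) d2 w2 w" "d1 < d2"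
    and "\<And>l. pval TYPE('p) (w1 l) \<ge> 0"
  shows "\<exists>n. \<forall>l\<ge>n. pval TYPE('p) (w2 l) > 0"
proof -
  obtain e1 where 1: "\<And>l. pval TYPE('p) (w1 l) = e1 + d1 * int l + pval TYPE('p) (w l)"
    using assms(1) by (rule twistE) blast
  obtain e2 where 2: "\<And>l. pval TYPE('p) (w2 l) = e2 + d2 * int l + pval TYPE('p) (w l)"
    using assms(2) by (rule twistE) blast
  have "pval TYPE('p) (w2 l) > 0" if "l \<ge> nat (e1 - e2 + 1)" for l
  proof -
    have "int l \<le> (d2 - d1) * int l"
      using assms(3) mult_right_mono[of 1 "d2 - d1" "int l"] by simp
    then have "d1 * int l + int l \<le> d2 * int l" by (simp add: left_diff_distrib)
    moreover have "int l \<ge> e1 - e2 + 1" using that by linarith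
    ultimately show ?thesis using assms(4)[of l] unfolding 1 2 by linarith
  qed
  then show ?thesis by blast
qed

text \<open>
  Follow the digits of \<open>c\<close> to a depth equal to the size of \<open>S\<close>. Among the sequences met at depths
  \<open>0, \<dots>, card S\<close> one repeats, with different slopes, so at one of the two depths the valuations are
  eventually positive. This depth may depend on \<open>c\<close>, but the section along \<open>c\<close> at full depth is a
  subsequence of the one at that depth.
\<close>

lemma self_similar_eventually_pos_pval:
  assumes S: "self_similar TYPE('p::prime_card) d S" "w \<in> S" and "d \<noteq> 0"
    and pos: "\<And>k. pval TYPE('p) (w k) \<ge> 0"
  shows "\<exists>n. \<forall>k\<ge>n. pval TYPE('p) (w k) > 0"
proof -
  define p where "p = CARD('p)"
  have p0: "p > 0" by (simp add: p_def)
  define s where "s t = d * (\<Sum>i<t. int p ^ i)" for t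
  define T where "T = card S"
  have *: "\<exists>n. \<forall>l\<ge>n. pval TYPE('p) (w (c + p ^ T * l)) > 0" if c: "c < p ^ T" for c
  proof -
    have "\<exists>w'\<in>S. twist TYPE('p) (s t) (\<lambda>l. w (c mod p ^ t + p ^ t * l)) w'" for t
      using self_similar_digits[OF S, of "c mod p ^ t" t] p0 unfolding s_def p_def by simp
    then obtain v where v: "\<And>t. v t \<in> S"
      "\<And>t. twist TYPE('p) (s t) (\<lambda>l. w (c mod p ^ t + p ^ t * l)) (v t)"
      by metis
    have "card (v ` {..T}) < card {..T}"
      using card_mono[of S "v ` {..T}"] S(1) v(1)
      by (auto simp: T_def self_similar_def image_subset_iff le_imp_less_Suc)
    then have "\<not> inj_on v {..T}" by (rule pigeonhole)
    then obtain t t' where t: "t \<le> T" "t' \<le> T" "t \<noteq> t'" "v t = v t'"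
      by (auto simp: inj_on_def)
    have "s t \<noteq> s t'"
    proof -
      have "strict_mono (\<lambda>t. \<Sum>i<t. int p ^ i)"
        unfolding strict_mono_Suc_iff using p0 by simp
      then show ?thesis
        using t(3) \<open>d \<noteq> 0\<close> strict_mono_eq[of "\<lambda>t. \<Sum>i<t. int p ^ i" t t'] by (simp add: s_def)
    qed
    then obtain r n where r: "r \<le> T" "\<And>l. l \<ge> n \<Longrightarrow> pval TYPE('p) (w (c mod p ^ r + p ^ r * l)) > 0"
    proof (cases "s t < s t'")
      case True
      then show ?thesis
        using twist_pos_pval[OF v(2)[of t] v(2)[of t', folded t(4)]] pos t(2) that by blast
    next
      case False
      with \<open>s t \<noteq> s t'\<close> have "s t' < s t" by simp
      then show ?thesis
        using twist_pos_pval[OF v(2)[of t', folded t(4)] v(2)[of t]] pos t(1) that by blast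
    qed
    have "pval TYPE('p) (w (c + p ^ T * l)) > 0" if "l \<ge> n" for l
    proof -
      have "c + p ^ T * l = c mod p ^ r + p ^ r * (c div p ^ r + p ^ (T - r) * l)"
        using r(1) by (simp add: distrib_left mult.assoc[symmetric] flip: power_add)
      moreover have "n \<le> c div p ^ r + p ^ (T - r) * l"
      proof -
        have "l \<le> p ^ (T - r) * l" using p0 by simp
        then show ?thesis using that by linarith
      qed
      ultimately show ?thesis using r(2) by metis
    qed
    then show ?thesis by blast
  qed
  then obtain n where n: "\<And>c l. c < p ^ T \<Longrightarrow> l \<ge> n c \<Longrightarrow> pval TYPE('p) (w (c + p ^ T * l)) > 0"
    by metis
  define N where "N = p ^ T * (\<Sum>c<p ^ T. n c)"
  have "pval TYPE('p) (w k) > 0" if "k \<ge> N" for k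
  proof -
    have c: "k mod p ^ T < p ^ T" using p0 by simp
    then have "n (k mod p ^ T) \<le> (\<Sum>c<p ^ T. n c)" by (intro member_le_sum) auto
    also have "\<dots> \<le> k div p ^ T"
      using that p0 by (simp add: N_def less_eq_div_iff_mult_less_eq mult.commute)
    finally have "pval TYPE('p) (w (k mod p ^ T + p ^ T * (k div p ^ T))) > 0"
      using n[OF c] by blast
    then show ?thesis by simp
  qed
  then show ?thesis by blast
qed

lemma algebraic_if_self_similar:
  assumes S: "self_similar TYPE('p::prime_card) d S" "w \<in> S"
    and int: "\<And>k. w k \<in> localization CARD('p)"
  shows "algebraic_over rational_functions (fps_to_fls (Abs_fps (\<lambda>k. rat_mod (w k)) :: 'p mod_ring fps))"
proof -
  define f :: "'p mod_ring fps" where "f = Abs_fps (\<lambda>k. rat_mod (w k))"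
  have w0: "w k \<noteq> 0" for k using S by (simp add: self_similar_def)
  note pos = pval_localization[OF int w0] and mod = rat_mod_eq_ac[OF int w0]
  show ?thesis
  proof (cases "d = 0")
    case True
    have "f = twisted_reduction 0 1 1 w"
      by (rule fps_ext) (simp add: f_def twisted_reduction_def mod)
    then have "f \<in> twisted_reductions S"
      unfolding twisted_reductions_def using S(2) pos
      by (intro CollectI exI[of _ 0] exI[of _ 1] exI[of _ w]) auto
    moreover have "finite (twisted_reductions S :: 'p mod_ring fps set)"
      using S(1) by (intro finite_twisted_reductions) (simp add: self_similar_def)
    ultimately show ?thesis
      unfolding f_def[symmetric] using S(1) True
      by (intro algebraic_if_finitely_many_sections[of "twisted_reductions S"]
          cartier_twisted_reductions) auto
  next
    case False
    then obtain n where "\<forall>k\<ge>n. pval TYPE('p) (w k) > 0"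
      using self_similar_eventually_pos_pval[OF S] pos by blast
    then show ?thesis
      unfolding f_def[symmetric]
      by (intro algebraic_if_eventually_zero[of n]) (auto simp: f_def mod)
  qed
qed

section \<open>Rising factorials are self-similar\<close>

lemma pochhammer_nonzero:
  fixes g :: rat
  assumes "g \<notin> \<int>\<^sub>\<le>\<^sub>0"
  shows "pochhammer g k \<noteq> 0"
  using assms by (auto simp: pochhammer_eq_0_iff)

lemma add_nat_nonzero:
  fixes g :: rat
  assumes "g \<notin> \<int>\<^sub>\<le>\<^sub>0"
  shows "g + of_nat k \<noteq> 0"
  using assms by (auto simp: add_eq_0_iff2)

text \<open>
  The factors \<open>\<gamma> + j\<close> with \<open>j\<close> not congruent to \<open>r\<close> are units with residue \<open>j - r\<close>; the others are
  \<open>p (\<gamma>' + i)\<close>. The product \<open>K\<close> collects the unit residues of an incomplete block and \<open>\<delta>\<close> counts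
  whether that block has reached \<open>r\<close>. Every complete block contributes \<open>K p\<close> (which is \<open>-1\<close> by Wilson's
  theorem). The value \<open>c = p\<close> is included because a shift by one in the argument
  can turn \<open>c = p - 1\<close> into it.
\<close>

lemma pochhammer_sections:
  fixes g g' :: rat and A B :: int
  assumes g: "g = of_int A / of_int B" "g \<notin> \<int>\<^sub>\<le>\<^sub>0"
    and B: "\<not> int CARD('p::prime_card) dvd B"
    and r: "r < CARD('p)" "int CARD('p) dvd A + int r * B"
    and g': "g' = (g + of_nat r) / of_nat CARD('p)" "g' \<notin> \<int>\<^sub>\<le>\<^sub>0"
    and c: "c \<le> CARD('p)"
  defines "K \<equiv> \<lambda>c. \<Prod>j\<in>{..<c} - {r}. of_nat j - of_nat r :: 'p mod_ring"
    and "\<delta> \<equiv> \<lambda>c. if r < c then 1 else 0 :: nat"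
  shows "pval TYPE('p) (pochhammer g (c + CARD('p) * l))
           = int l + int (\<delta> c) + pval TYPE('p) (pochhammer g' (l + \<delta> c))" (is "?V l c")
    and "ac (pochhammer g (c + CARD('p) * l))
           = K c * K CARD('p) ^ l * ac (pochhammer g' (l + \<delta> c))" (is "?A l c")
proof -
  define p where "p = CARD('p)"
  have p: "prime (int p)" using prime_card_int[where 'a = 'p] by (simp add: p_def)
  have p0: "p > 0" by (simp add: p_def)
  have B0: "B \<noteq> 0" using B by auto
  have unit: "pval TYPE('p) (g + of_nat (j + p * l)) = 0"
    "(ac (g + of_nat (j + p * l)) :: 'p mod_ring) = of_nat j - of_nat r"
    if j: "j < p" "j \<noteq> r" for j l
  proof -
    define n where "n = A + int (j + p * l) * B"
    have n: "n = (A + int r * B) + (int j - int r + int p * int l) * B"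
      by (simp add: n_def algebra_simps)
    have "\<not> int p dvd int j - int r"
    proof
      assume "int p dvd int j - int r"
      moreover have "\<bar>int j - int r\<bar> < int p" using j(1) r(1) by (simp add: p_def)
      ultimately have "int j - int r = 0" using dvd_imp_le_int[of "int j - int r" "int p"] by fastforce
      then show False using j(2) by simp
    qed
    then have "\<not> int p dvd int j - int r + int p * int l"
      by (metis dvd_add_left_iff dvd_triv_left)
    then have ndvd: "\<not> int p dvd n"
      using r(2) B p unfolding n by (simp add: dvd_add_right_iff prime_dvd_mult_iff p_def)
    have B': "(of_int B :: 'p mod_ring) \<noteq> 0" using B by (simp add: of_int_mod_ring_eq_0_iff)
    have "(of_int (A + int r * B) :: 'p mod_ring) = 0"
      using r(2) unfolding of_int_mod_ring_eq_0_iff .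
    moreover have "(of_nat p :: 'p mod_ring) = 0" by (simp add: p_def)
    ultimately have "of_int n = (of_nat j - of_nat r) * (of_int B :: 'p mod_ring)"
      unfolding n of_int_add[of "A + int r * B"] by simp
    then have "of_int n / of_int B = (of_nat j - of_nat r :: 'p mod_ring)" using B' by simp
    moreover have "g + of_nat (j + p * l) = of_int n / of_int B"
      using B0 by (simp add: g n_def field_simps)
    ultimately have "leading_term (g + of_nat (j + p * l)) 0 (of_nat j - of_nat r :: 'p mod_ring)"
      using leading_term_fraction[of n B, where 'p = 'p] ndvd B by (simp add: p_def)
    from leading_term_imp[OF this] show "pval TYPE('p) (g + of_nat (j + p * l)) = 0"
      "(ac (g + of_nat (j + p * l)) :: 'p mod_ring) = of_nat j - of_nat r" .
  qed
  have multiple: "g + of_nat (r + p * l) = of_nat p * (g' + of_nat l)" for l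
    using p0 by (simp add: g'(1) field_simps flip: p_def)
  have base: "pval TYPE('p) 1 = 0" "(ac 1 :: 'p mod_ring) = 1"
    using leading_term_imp[OF leading_term_one[where 'p = 'p]] by auto
  have prime: "pval TYPE('p) (of_nat p) = 1" "(ac (of_nat p) :: 'p mod_ring) = 1"
    using leading_term_imp[OF leading_term_prime[where 'p = 'p]] by (auto simp: p_def)
  have nz: "g + of_nat k \<noteq> 0" "pochhammer g k \<noteq> 0" "g' + of_nat k \<noteq> 0" "pochhammer g' k \<noteq> 0" for k
    using g(2) g'(2) by (simp_all add: pochhammer_nonzero add_nat_nonzero)
  have step: "?V l (Suc c) \<and> ?A l (Suc c)" if IH: "?V l c \<and> ?A l c" and c: "c < p" for l c
  proof (cases "c = r")
    case True
    have "{..<Suc r} - {r} = {..<r} - {r}" by auto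
    then have K: "K (Suc r) = K r" by (simp add: K_def)
    have "pochhammer g (Suc c + p * l) = pochhammer g (c + p * l) * (of_nat p * (g' + of_nat l))"
      using multiple[of l] True by (simp add: pochhammer_Suc)
    then show ?thesis
      using IH True p0 K
      by (simp add: p_def[symmetric] \<delta>_def pochhammer_Suc pval_mult ac_mult nz prime)
  next
    case False
    have "{..<Suc c} - {r} = insert c ({..<c} - {r})" using False by auto
    then have K: "K (Suc c) = (of_nat c - of_nat r) * K c" by (simp add: K_def)
    have \<delta>: "\<delta> (Suc c) = \<delta> c" using False by (auto simp: \<delta>_def)
    have "pochhammer g (Suc c + p * l) = pochhammer g (c + p * l) * (g + of_nat (c + p * l))"
      by (simp add: pochhammer_Suc)
    then show ?thesis
      using IH K \<delta> nz(1)[of "c + p * l"] nz(2)[of "c + p * l"] unit[OF c False, of l]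
      by (simp add: p_def[symmetric] pval_mult ac_mult mult_ac del: of_nat_add)
  qed
  \<comment> \<open>The claim for a full block, \<open>(l, p)\<close>, is literally the claim for \<open>(l + 1, 0)\<close>.\<close>
  have main: "\<forall>c\<le>p. ?V l c \<and> ?A l c" for l
  proof (induct l)
    case 0
    have "?V 0 c \<and> ?A 0 c" if "c \<le> p" for c
      using that
    proof (induct c)
      case 0
      show ?case by (simp add: \<delta>_def K_def base)
    next
      case (Suc c)
      then show ?case using step[of c 0] by simp
    qed
    then show ?case by blast
  next
    case (Suc l)
    have "?V (Suc l) c \<and> ?A (Suc l) c" if "c \<le> p" for c
      using that
    proof (induct c)
      case 0
      have "?V l p \<and> ?A l p" using Suc by blast
      then show ?case using r(1) by (simp add: \<delta>_def K_def flip: p_def)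
    next
      case (Suc c)
      then show ?case using step[of c "Suc l"] by simp
    qed
    then show ?case by blast
  qed
  show "?V l c" "?A l c" using main c by (auto simp: p_def)
qed

text \<open>
  The bound on the numerator \<open>A'\<close> is what makes the orbit of \<open>\<gamma>\<close> under the Dwork prime finite: as
  \<open>p A' = A + r B\<close> with \<open>r \<le> p - 1\<close>, the maximum of \<open>|A|\<close> and \<open>|B|\<close> does not grow.
\<close>

lemma dwork_prime_exists:
  fixes g :: rat
  assumes g: "g = of_int A / of_int B" "g \<notin> \<int>\<^sub>\<le>\<^sub>0" and B: "\<not> int CARD('p::prime_card) dvd B"
  obtains r A' g' where "r < CARD('p)" "int CARD('p) dvd A + int r * B"
    "g' = (g + of_nat r) / of_nat CARD('p)" "g' \<notin> \<int>\<^sub>\<le>\<^sub>0"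
    "g' = of_int A' / of_int B" "\<bar>A'\<bar> \<le> max \<bar>A\<bar> \<bar>B\<bar>"
proof -
  define p where "p = CARD('p)"
  have p: "prime (int p)" using prime_card_int[where 'a = 'p] by (simp add: p_def)
  have p0: "p > 0" by (simp add: p_def)
  have B0: "B \<noteq> 0" using B by auto
  have "coprime B (int p)"
    using p B prime_imp_coprime coprime_commute unfolding p_def by metis
  then obtain x where x: "[B * x = 1] (mod int p)"
    using cong_solve_coprime_int by blast
  define r where "r = nat ((- A * x) mod int p)"
  have r: "int r = (- A * x) mod int p" using p0 by (simp add: r_def)
  have "r < p" using p0 by (simp add: r_def nat_less_iff)
  have "[A + int r * B = A + (- A * x) * B] (mod int p)"
    unfolding r by (intro cong_add cong_mult) (auto simp: cong_def)
  also have "A + (- A * x) * B = A - A * (B * x)" by simp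
  also have "[A - A * (B * x) = A - A * 1] (mod int p)"
    using x by (intro cong_diff cong_mult) auto
  finally have dvd: "int p dvd A + int r * B" by (simp add: cong_0_iff)
  then obtain A' where A': "A + int r * B = int p * A'" by blast
  define g' where "g' = (g + of_nat r) / of_nat p"
  have "g' = (of_int (A + int r * B) / of_int B) / of_nat p"
    using B0 by (simp add: g'_def g field_simps)
  also have "\<dots> = of_int A' / of_int B"
    unfolding A' using p0 by simp
  finally have g'_eq: "g' = of_int A' / of_int B" .
  have "g' \<notin> \<int>\<^sub>\<le>\<^sub>0"
  proof
    assume "g' \<in> \<int>\<^sub>\<le>\<^sub>0"
    then obtain k where "g' = - of_nat k" by (auto elim: nonpos_Ints_cases')
    then have "g = - of_nat (p * k + r)" using p0 by (simp add: g'_def field_simps)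
    then show False using g(2) by blast
  qed
  moreover have "\<bar>A'\<bar> \<le> max \<bar>A\<bar> \<bar>B\<bar>"
  proof -
    define M where "M = max \<bar>A\<bar> \<bar>B\<bar>"
    have "int p * \<bar>A'\<bar> = \<bar>A + int r * B\<bar>" using A' by (simp add: abs_mult)
    also have "\<dots> \<le> \<bar>A\<bar> + int r * \<bar>B\<bar>"
      using abs_triangle_ineq[of A "int r * B"] by (simp add: abs_mult)
    also have "\<dots> \<le> M + (int p - 1) * M"
      using \<open>r < p\<close> by (intro add_mono mult_mono) (auto simp: M_def)
    also have "\<dots> = int p * M" by (simp add: algebra_simps)
    finally show ?thesis using p0 by (simp add: M_def)
  qed
  ultimately show ?thesis
    using that[of r g' A'] \<open>r < p\<close> dvd g'_eq by (simp add: g'_def p_def)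
qed

text \<open>
  The family consists of the rising factorials of all fractions with denominator \<open>B\<close> and bounded
  numerator. It also contains the sequences shifted by one, because the section of an unshifted
  sequence may be shifted; a second section does not increase the shift further.
\<close>

lemma self_similar_pochhammer_integral:
  fixes g :: rat
  assumes g: "g = of_int A / of_int B" "g \<notin> \<int>\<^sub>\<le>\<^sub>0" and B: "\<not> int CARD('p::prime_card) dvd B"
  shows "\<exists>S. self_similar TYPE('p) 1 S \<and> pochhammer g \<in> S"
proof -
  define M where "M = max \<bar>A\<bar> \<bar>B\<bar>"
  define G :: "rat set" where "G = (\<lambda>n. of_int n / of_int B) ` {-M..M} - \<int>\<^sub>\<le>\<^sub>0"
  define S where "S = (\<lambda>(x, \<epsilon>) l. pochhammer x (l + \<epsilon>)) ` (G \<times> {0, 1 :: nat})"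
  have "self_similar TYPE('p) 1 S"
    unfolding self_similar_def
  proof (intro conjI ballI allI impI)
    show "finite S" by (simp add: S_def G_def)
    fix w assume "w \<in> S"
    then obtain x \<epsilon> where x: "x \<in> G" "\<epsilon> \<le> 1" "w = (\<lambda>l. pochhammer x (l + \<epsilon>))"
      by (auto simp: S_def)
    show "w l \<noteq> 0" for l using x by (auto simp: G_def pochhammer_nonzero)
    fix a assume a: "a < CARD('p)"
    obtain n where "n \<in> {-M..M}" and n': "x = of_int n / of_int B" "x \<notin> \<int>\<^sub>\<le>\<^sub>0"
      using x(1) unfolding G_def by blast
    then have n: "x = of_int n / of_int B" "\<bar>n\<bar> \<le> M" "x \<notin> \<int>\<^sub>\<le>\<^sub>0" by auto
    obtain r n' x' where x': "r < CARD('p)" "int CARD('p) dvd n + int r * B"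
      "x' = (x + of_nat r) / of_nat CARD('p)" "x' \<notin> \<int>\<^sub>\<le>\<^sub>0"
      "x' = of_int n' / of_int B" "\<bar>n'\<bar> \<le> max \<bar>n\<bar> \<bar>B\<bar>"
      using dwork_prime_exists[OF n(1,3) B] .
    have "\<bar>n'\<bar> \<le> M" using x'(6) n(2) unfolding M_def by arith
    then have "n' \<in> {-M..M}" by auto
    then have "x' \<in> G" using x'(4,5) unfolding G_def by blast
    define \<delta> where "\<delta> = (if r < a + \<epsilon> then 1 else 0 :: nat)"
    have "a + \<epsilon> \<le> CARD('p)" using a x(2) by simp
    note sections = pochhammer_sections[OF n(1,3) B x'(1-4) this, folded \<delta>_def]
    have "a + CARD('p) * l + \<epsilon> = (a + \<epsilon>) + CARD('p) * l" for l by simp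
    then have "twist TYPE('p) 1 (\<lambda>l. w (a + CARD('p) * l)) (\<lambda>l. pochhammer x' (l + \<delta>))"
      unfolding x(3) by (simp only:) (rule twistI[where e = "int \<delta>"], simp add: sections, rule sections)
    moreover have "(\<lambda>l. pochhammer x' (l + \<delta>)) \<in> S"
      using \<open>x' \<in> G\<close> unfolding S_def by (intro image_eqI[of _ _ "(x', \<delta>)"]) (auto simp: \<delta>_def)
    ultimately show "\<exists>w'\<in>S. twist TYPE('p) 1 (\<lambda>l. w (a + CARD('p) * l)) w'" by blast
  qed
  moreover have "A \<in> {-M..M}" by (auto simp: M_def)
  then have "pochhammer g \<in> S"
    using g unfolding S_def G_def by (intro image_eqI[of _ _ "(g, 0)"]) auto
  ultimately show ?thesis by blast
qed

text \<open>
  Adding an integer to a number of negative valuation does not change its leading term, so \<open>(\<gamma>)\<^sub>k\<close> has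
  the leading term of \<open>\<gamma>\<^sup>k\<close>.
\<close>

lemma self_similar_pochhammer_nonintegral:
  fixes g :: rat
  assumes g: "g \<notin> \<int>\<^sub>\<le>\<^sub>0" and neg: "pval TYPE('p::prime_card) g < 0"
  shows "self_similar TYPE('p) ((int CARD('p) - 1) * pval TYPE('p) g) {pochhammer g}"
proof -
  define p where "p = CARD('p)"
  have "g \<noteq> 0" using g by auto
  define v where "v = pval TYPE('p) g"
  define n where "n = nat (- v)"
  have v: "v = - int n" "n > 0" using neg by (simp_all add: n_def v_def)
  have nz: "g + of_nat k \<noteq> 0" "pochhammer g k \<noteq> 0" for k
    using g by (simp_all add: pochhammer_nonzero add_nat_nonzero)
  obtain a b where ab: "\<not> int p dvd a" "\<not> int p dvd b"
    "g = of_nat p powi v * (of_int a / of_int b)" "(ac g :: 'p mod_ring) = of_int a / of_int b"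
    using leading_term_pval_ac[OF \<open>g \<noteq> 0\<close>, where 'p = 'p]
    by (auto simp: leading_term_def p_def v_def)
  have p0: "p > 0" by (simp add: p_def)
  have b0: "b \<noteq> 0" using ab by auto
  have shift: "pval TYPE('p) (g + of_nat k) = v" "(ac (g + of_nat k) :: 'p mod_ring) = ac g" for k
  proof -
    define a' where "a' = a + int k * int p ^ n * b"
    have dvd: "int p dvd int k * int p ^ n * b" using v(2) by (cases n) auto
    then have "\<not> int p dvd a'" using ab(1) by (simp add: a'_def dvd_add_left_iff)
    moreover have "of_int a' = (of_int a :: 'p mod_ring)"
    proof -
      have "of_int (int k * int p ^ n * b) = (0 :: 'p mod_ring)"
        using dvd unfolding of_int_mod_ring_eq_0_iff p_def .
      then show ?thesis unfolding a'_def of_int_add by simp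
    qed
    moreover have "g + of_nat k = of_nat p powi v * (of_int a' / of_int b)"
      using p0 b0 by (simp add: ab(3) v(1) a'_def power_int_minus field_simps)
    ultimately have "leading_term (g + of_nat k) v (ac g :: 'p mod_ring)"
      unfolding leading_term_def ab(4) using ab(2)
      by (intro exI[of _ a'] exI[of _ b]) (simp add: p_def)
    from leading_term_imp[OF this] show "pval TYPE('p) (g + of_nat k) = v"
      "(ac (g + of_nat k) :: 'p mod_ring) = ac g" .
  qed
  have poch: "pval TYPE('p) (pochhammer g k) = int k * v \<and> (ac (pochhammer g k) :: 'p mod_ring) = ac g ^ k" for k
  proof (induct k)
    case 0
    show ?case using leading_term_imp[OF leading_term_one[where 'p = 'p]] by simp
  next
    case (Suc k)
    then show ?case
      by (simp add: pochhammer_Suc pval_mult ac_mult nz shift distrib_right)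
  qed
  have "twist TYPE('p) ((int p - 1) * v) (\<lambda>l. pochhammer g (a + p * l)) (pochhammer g)" for a
  proof (rule twistI[where e = "int a * v" and C = "ac g ^ a" and D = "ac g ^ (p - 1)"])
    fix l
    show "pval TYPE('p) (pochhammer g (a + p * l))
        = int a * v + (int p - 1) * v * int l + pval TYPE('p) (pochhammer g l)"
      by (simp add: poch algebra_simps)
    have "a + p * l = a + (p - 1) * l + l" using p0 by (cases p) auto
    then show "(ac (pochhammer g (a + p * l)) :: 'p mod_ring)
        = ac g ^ a * (ac g ^ (p - 1)) ^ l * ac (pochhammer g l)"
      by (simp only: poch power_add power_mult)
  qed
  then show ?thesis
    by (simp add: self_similar_def nz p_def v_def)
qed

lemma self_similar_pochhammer:
  fixes g :: rat
  assumes g: "g \<notin> \<int>\<^sub>\<le>\<^sub>0"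
  shows "\<exists>d S. self_similar TYPE('p::prime_card) d S \<and> pochhammer g \<in> S"
proof (cases "pval TYPE('p) g < 0")
  case True
  then show ?thesis using self_similar_pochhammer_nonintegral[OF g] by blast
next
  case False
  define v where "v = nat (pval TYPE('p) g)"
  have v: "pval TYPE('p) g = int v" using False by (simp add: v_def)
  have "g \<noteq> 0" using g by auto
  then obtain a b where "\<not> int CARD('p) dvd b" "g = of_nat CARD('p) powi int v * (of_int a / of_int b)"
    using leading_term_pval_ac[of g, where 'p = 'p] unfolding v leading_term_def by blast
  then show ?thesis
    using self_similar_pochhammer_integral[of g "int CARD('p) ^ v * a" b, where 'p = 'p] g by auto
qed

section \<open>Hypergeometric series\<close>

theorem theorem3p9:
  fixes p n m :: nat and \<alpha> \<beta> :: "nat \<Rightarrow> rat"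
  assumes "prime p" and "CARD('p::prime_card) = p"
    and "\<And>i. i \<in> {1..n} \<Longrightarrow> \<alpha> i \<notin> \<int>\<^sub>\<le>\<^sub>0"
    and "\<And>j. j \<in> {1..m} \<Longrightarrow> \<beta> j \<notin> \<int>\<^sub>\<le>\<^sub>0"
    and "good_reduction p (hypergeom_series n m \<alpha> \<beta>)"
  shows "algebraic_over rational_functions
           (fps_to_fls (fps_mod (hypergeom_series n m \<alpha> \<beta>) :: 'p mod_ring fps))"
proof -
  define w where "w = fps_nth (hypergeom_series n m \<alpha> \<beta>)"
  obtain d S where S: "self_similar TYPE('p) d S" "(\<lambda>k. \<Prod>i=1..n. pochhammer (\<alpha> i) k) \<in> S"
    using self_similar_prod[of "{1..n}" "\<lambda>i. pochhammer (\<alpha> i)", where 'p = 'p]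
      self_similar_pochhammer assms(3) by blast
  obtain d' S' where S': "self_similar TYPE('p) d' S'" "(\<lambda>k. \<Prod>j=1..m. pochhammer (\<beta> j) k) \<in> S'"
    using self_similar_prod[of "{1..m}" "\<lambda>j. pochhammer (\<beta> j)", where 'p = 'p]
      self_similar_pochhammer assms(4) by blast
  \<comment> \<open>Numerator and denominator are treated separately and combined by closure under inverses
    and products.\<close>
  define S'' where "S'' = (\<lambda>w l. inverse (w l)) ` S'"
  have "(\<lambda>k. inverse (\<Prod>j=1..m. pochhammer (\<beta> j) k)) \<in> S''"
    using S'(2) unfolding S''_def by (rule rev_image_eqI) simp
  then have "w \<in> (\<lambda>(v, w) l. v l * w l) ` (S \<times> S'')"
    using S(2)
    by (intro image_eqI[of _ _ "(\<lambda>k. \<Prod>i=1..n. pochhammer (\<alpha> i) k, \<lambda>k. inverse (\<Prod>j=1..m. pochhammer (\<beta> j) k))"])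
      (auto simp: w_def hypergeom_series_def divide_inverse)
  moreover have "self_similar TYPE('p) (d + - d') ((\<lambda>(v, w) l. v l * w l) ` (S \<times> S''))"
    unfolding S''_def by (intro self_similar_mult self_similar_inverse S S')
  moreover have "w k \<in> localization CARD('p)" for k
    using assms(2,5) by (simp add: good_reduction_def w_def)
  ultimately have "algebraic_over rational_functions
      (fps_to_fls (Abs_fps (\<lambda>k. rat_mod (w k)) :: 'p mod_ring fps))"
    using algebraic_if_self_similar by blast
  then show ?thesis by (simp add: fps_mod_def w_def)
qed
end
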